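(* Let $n\ge 22$. Then $\mathbb{E}(T_n(2,2|2,2))<\mathbb{E}(P_n(2,1,n-4))$.
   Context: The energy $\mathbb{E}(G)$ is the sum of absolute values of the adjacency eigenvalues of $G$. $P_n(a_1,\dots,a_k)$ ($k\ge3$, $a_i\ge1$, $\sum a_i=n-1$) is the tree of order $n$ consisting of a central vertex with $k$ internally disjoint pendent paths of lengths $a_1,\dots,a_k$. $T_n(2,2|2,2)$ is the tree of order $n$ obtained from the path $P_{n-8}$ by attaching two pendent paths of length $2$ at each of its two end vertices. *)

theory Defs
  imports
    Graph_Theory.Pair_Digraph
    Jordan_Normal_Form.Char_Poly
begin

section \<open>Graph energy\<close>

text \<open>A simple graph is a finite symmetric loopless relation, i.e. an instance of the locale
  \<^locale>\<open>pair_graph\<close>. The vertices are enumerated in increasing order.\<close>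

definition adjacency_mat :: "'a :: linorder pair_pre_digraph \<Rightarrow> real mat" where
  "adjacency_mat G =
    (let vs = sorted_list_of_set (pverts G); n = card (pverts G)
     in mat n n (\<lambda>(i, j). if (vs ! i, vs ! j) \<in> parcs G then 1 else 0))"

text \<open>Eigenvalues are counted with algebraic multiplicity. The adjacency matrix of a simple graph
  is real symmetric, so its real eigenvalues are all of its eigenvalues.\<close>

definition graph_energy :: "'a :: linorder pair_pre_digraph \<Rightarrow> real" where
  "graph_energy G =
    (\<Sum>x | eigenvalue (adjacency_mat G) x.
       real (Polynomial.order x (char_poly (adjacency_mat G))) * \<bar>x\<bar>)"

section \<open>The two families of trees\<close>

text \<open>The path with \<open>m\<close> vertices; its end vertices are \<open>0\<close> and \<open>m - 1\<close>.\<close>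

definition path_graph :: "nat \<Rightarrow> nat pair_pre_digraph" where
  "path_graph m = \<lparr> pverts = {..<m}, parcs = symcl {(i, Suc i) | i. Suc i < m} \<rparr>"

text \<open>Attach to the vertex \<open>v\<close> a pendent path of length \<open>l\<close>, i.e. with \<open>l\<close> new edges and \<open>l\<close> new
  vertices. If \<open>G\<close> has vertex set \<open>{..<N}\<close>, the new path is \<open>v, N, N + 1, \<dots>, N + l - 1\<close>.\<close>

definition attach_path :: "nat \<Rightarrow> nat \<Rightarrow> nat pair_pre_digraph \<Rightarrow> nat pair_pre_digraph" where
  "attach_path v l G =
    (let N = card (pverts G)
     in \<lparr> pverts = pverts G \<union> {N..<N + l},
          parcs = parcs G \<union>
            symcl {(if i = 0 then v else N + i - 1, N + i) | i. i < l} \<rparr>)"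

text \<open>\<open>starlike_tree [a\<^sub>1, \<dots>, a\<^sub>k]\<close> is \<open>P\<^sub>n(a\<^sub>1, \<dots>, a\<^sub>k)\<close>, with centre \<open>0\<close>;
  the order \<open>n = a\<^sub>1 + \<dots> + a\<^sub>k + 1\<close> is determined by the list.\<close>

definition starlike_tree :: "nat list \<Rightarrow> nat pair_pre_digraph" where
  "starlike_tree as = fold (attach_path 0) as (path_graph 1)"

text \<open>\<open>T\<^sub>n(2,2|2,2)\<close>, intended for \<open>n \<ge> 10\<close>; the end vertices of the path with \<open>n - 8\<close> vertices
  are \<open>0\<close> and \<open>n - 9\<close>.\<close>

definition tree_T2222 :: "nat \<Rightarrow> nat pair_pre_digraph" where
  "tree_T2222 n =
    attach_path (n - 9) 2 (attach_path (n - 9) 2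
      (attach_path 0 2 (attach_path 0 2 (path_graph (n - 8)))))"

section \<open>Vertex sets and well-formedness\<close>

lemma symcl_iff: "(a, b) \<in> symcl R \<longleftrightarrow> (a, b) \<in> R \<or> (b, a) \<in> R"
  by (auto simp: symcl_def intro: rev_image_eqI[of "(b, a)"])

lemma pverts_path_graph [simp]: "pverts (path_graph m) = {..<m}"
  by (simp add: path_graph_def)

lemma pverts_attach_path:
  "pverts G = {..<N} \<Longrightarrow> pverts (attach_path v l G) = {..<N + l}"
  by (simp add: attach_path_def ivl_disj_un_one(2))

lemma pair_graphI:
  assumes "finite (pverts G)" "parcs G \<subseteq> pverts G \<times> pverts G" "sym (parcs G)" "irrefl (parcs G)"
  shows "pair_graph G"
proof -
  have "finite (parcs G)"
    by (rule finite_subset[OF assms(2)]) (simp add: assms(1))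
  show ?thesis
  proof
    show "finite (pverts G)" "finite (parcs G)" by fact+
    show "symmetric (with_proj G)"
      unfolding symmetric_def with_proj_simps by fact
    fix e assume e: "e \<in> parcs G"
    then show "fst e \<in> pverts G" "snd e \<in> pverts G"
      using subsetD[OF assms(2) e] by (simp_all add: mem_Times_iff)
    show "fst e \<noteq> snd e"
      using e irreflD[OF assms(4), of "fst e"] by (cases e) auto
  qed
qed

lemma pair_graph_path_graph: "pair_graph (path_graph m)"
proof (rule pair_graphI)
  show "parcs (path_graph m) \<subseteq> pverts (path_graph m) \<times> pverts (path_graph m)"
    by (auto simp: path_graph_def symcl_iff)
  show "sym (parcs (path_graph m))"
    by (rule symI) (auto simp: path_graph_def symcl_iff)
  show "irrefl (parcs (path_graph m))"
    by (rule irreflI) (auto simp: path_graph_def symcl_iff)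
qed simp

lemma pair_graphD:
  assumes "pair_graph G"
  shows "sym (parcs G)"
    and "(a, b) \<in> parcs G \<Longrightarrow> a \<in> pverts G \<and> b \<in> pverts G \<and> a \<noteq> b"
proof -
  interpret pair_graph G by (rule assms)
  show "sym (parcs G)"
    using pair_sym_arcs unfolding symmetric_def with_proj_simps .
  show "a \<in> pverts G \<and> b \<in> pverts G \<and> a \<noteq> b" if "(a, b) \<in> parcs G"
    using in_arcsD1[OF that] in_arcsD2[OF that] pair_no_loops[OF that] unfolding fst_conv snd_conv by blast
qed

lemma pair_graph_attach_path:
  assumes G: "pair_graph G" and V: "pverts G = {..<N}" and v: "v < N"
  shows "pair_graph (attach_path v l G)"
proof -
  note s = pair_graphD(1)[OF G]
  have b: "a < N \<and> b < N \<and> a \<noteq> b" if "(a, b) \<in> parcs G" for a b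
    using pair_graphD(2)[OF G that] V by simp
  have e: "a < N + l \<and> b < N + l \<and> a \<noteq> b" if "(a, b) \<in> parcs (attach_path v l G)" for a b
  proof -
    let ?w = "\<lambda>i. if i = 0 then v else N + i - 1"
    have "parcs (attach_path v l G) = parcs G \<union> symcl {(?w i, N + i) | i. i < l}"
      by (simp add: attach_path_def V)
    with that have "(a, b) \<in> parcs G \<or> (\<exists>i<l. a = ?w i \<and> b = N + i) \<or> (\<exists>i<l. b = ?w i \<and> a = N + i)"
      by (simp only: Un_iff symcl_iff mem_Collect_eq prod.inject) blast
    then consider "(a, b) \<in> parcs G" | i where "i < l" "a = ?w i" "b = N + i"
      | i where "i < l" "b = ?w i" "a = N + i"
      by blast
    then show ?thesis
    proof cases
      case 1
      from b[OF this] show ?thesis by simp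
    next
      case (2 i)
      with v show ?thesis by (auto split: if_splits)
    next
      case (3 i)
      with v show ?thesis by (auto split: if_splits)
    qed
  qed
  show ?thesis
  proof (rule pair_graphI)
    show "sym (parcs (attach_path v l G))"
    proof (rule symI)
      fix a b assume "(a, b) \<in> parcs (attach_path v l G)"
      then show "(b, a) \<in> parcs (attach_path v l G)"
        unfolding attach_path_def Let_def pair_pre_digraph.simps Un_iff symcl_iff
        using symD[OF s, of a b] by blast
    qed
    show "irrefl (parcs (attach_path v l G))"
      using e by (intro irreflI) blast
    show "parcs (attach_path v l G) \<subseteq> pverts (attach_path v l G) \<times> pverts (attach_path v l G)"
      using e by (auto simp: pverts_attach_path[OF V])
  qed (simp add: pverts_attach_path[OF V])
qed

lemma starlike_tree_wf:
  "pverts (starlike_tree as) = {..<sum_list as + 1} \<and> pair_graph (starlike_tree as)"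
proof (induction as rule: rev_induct)
  case Nil
  then show ?case
    by (simp add: starlike_tree_def pair_graph_path_graph)
next
  case (snoc a as)
  have "starlike_tree (as @ [a]) = attach_path 0 a (starlike_tree as)"
    by (simp add: starlike_tree_def)
  with snoc show ?case
    by (simp add: pverts_attach_path pair_graph_attach_path add_ac)
qed

lemma tree_T2222_wf:
  assumes "n \<ge> 9"
  shows "pverts (tree_T2222 n) = {..<n} \<and> pair_graph (tree_T2222 n)"
proof -
  let ?P = "path_graph (n - 8)"
  let ?A = "attach_path 0 2 ?P"
  let ?B = "attach_path 0 2 ?A"
  let ?C = "attach_path (n - 9) 2 ?B"
  have A: "pverts ?A = {..<n - 6}"
    using assms by (subst pverts_attach_path[where N = "n - 8"]) auto
  have B: "pverts ?B = {..<n - 4}"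
    using assms by (subst pverts_attach_path[OF A]) auto
  have C: "pverts ?C = {..<n - 2}"
    using assms by (subst pverts_attach_path[OF B]) auto
  have D: "pverts (attach_path (n - 9) 2 ?C) = {..<n}"
    using assms by (subst pverts_attach_path[OF C]) auto
  have "pair_graph ?A"
    using assms by (intro pair_graph_attach_path[where N = "n - 8"] pair_graph_path_graph) auto
  then have "pair_graph ?B"
    using assms by (intro pair_graph_attach_path[OF _ A]) auto
  then have "pair_graph ?C"
    using assms by (intro pair_graph_attach_path[OF _ B]) auto
  then have "pair_graph (attach_path (n - 9) 2 ?C)"
    using assms by (intro pair_graph_attach_path[OF _ C]) auto
  with D show ?thesis
    by (simp add: tree_T2222_def)
qed

end

theory Submission
  imports Defs "HOL-Real_Asymp.Real_Asymp"
begin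

text \<open>
  For a tree \<open>G\<close> of order \<open>n\<close> let \<open>g(y) = \<bar>\<phi>(G, \<i> y)\<bar>\<close> be the modulus of its characteristic polynomial on the
  imaginary axis. By Coulson's formula the difference of the energies of two trees is the integral
  of the logarithm of the ratio of these functions. Write \<open>t\<^sub>n\<close> and \<open>e\<^sub>n\<close> for the functions of
  \<open>T\<^sub>n(2,2|2,2)\<close> and \<open>P\<^sub>n(2,1,n-4)\<close>. As functions of \<open>n\<close>, both satisfy \<open>f\<^sub>n\<^sub>+\<^sub>2 = y f\<^sub>n\<^sub>+\<^sub>1 + f\<^sub>n\<close>, and hence
  so does \<open>t\<^sub>2\<^sub>3 e\<^sub>n (y\<^sup>2 + r\<^sup>2) - t\<^sub>n e\<^sub>2\<^sub>3 (y\<^sup>2 + 1)\<close> for every constant \<open>r\<close>. With \<open>r\<close> slightly larger than \<open>1\<close> it is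
  nonnegative for \<open>n = 22\<close> and \<open>n = 23\<close>, hence for all \<open>n \<ge> 22\<close>, so the energy difference of the two
  trees is at most the one for \<open>n = 23\<close> plus \<open>2 (r - 1)\<close>. The case \<open>n = 23\<close>, the tightest one, leaves a
  gap of about \<open>0.0004\<close>, which is certified by rational bounds on the eigenvalues.
\<close>

section \<open>Characteristic polynomials via vertex deletion\<close>

text \<open>The Leibniz determinant over an arbitrary index set. Principal minors, and hence
  vertex-deleted subgraphs, are then obtained by changing \<open>S\<close> alone, without
  renumbering rows and columns.\<close>

definition set_det :: "(nat \<Rightarrow> nat \<Rightarrow> 'a) \<Rightarrow> nat set \<Rightarrow> 'a :: comm_ring_1" where
  "set_det M S = (\<Sum>p | p permutes S. signof p * (\<Prod>i\<in>S. M i (p i)))"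

lemma set_det_empty [simp]: "set_det M {} = 1"
  by (simp add: set_det_def)

lemma det_eq_set_det: "det (mat n n (\<lambda>(i, j). M i j)) = set_det M {..<n}"
proof -
  have "(\<Prod>i = 0..<n. mat n n (\<lambda>(i, j). M i j) $$ (i, p i)) = (\<Prod>i = 0..<n. M i (p i))"
    if "p permutes {0..<n}" for p
    using permutes_in_image[OF that] by (intro prod.cong) auto
  then have "det (mat n n (\<lambda>(i, j). M i j)) =
      (\<Sum>p | p permutes {0..<n}. signof p * (\<Prod>i = 0..<n. M i (p i)))"
    by (subst det_def'[of _ n]) (auto intro!: sum.cong)
  then show ?thesis
    by (simp add: set_det_def atLeast0LessThan)
qed

text \<open>Every permutation of \<open>insert w S\<close> is uniquely
  \<open>transpose w b \<circ> q\<close> with \<open>q\<close> permuting \<open>S\<close>. The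
  choice \<open>b = w\<close> fixes \<open>w\<close>; every other \<open>b\<close> costs one sign
  change.\<close>

lemma set_det_insert:
  assumes fin: "finite S" and w: "w \<notin> S"
  shows "set_det M (insert w S) = M w w * set_det M S -
    (\<Sum>b\<in>S. M w b * (\<Sum>q | q permutes S. signof q * (\<Prod>i\<in>S. M i (transpose w b (q i)))))"
  (is "_ = _ - (\<Sum>b\<in>S. _ * ?c b)")
proof -
  let ?f = "\<lambda>p. signof p * (\<Prod>i\<in>insert w S. M i (p i)) :: 'a"
  have perm_term: "?f (transpose w b \<circ> q) =
      (if b = w then 1 else - 1) * M w b * (signof q * (\<Prod>i\<in>S. M i (transpose w b (q i))))"
    if q: "q permutes S" for b q
  proof -
    have "q w = w"
      using q w by (simp add: permutes_not_in)
    moreover have "sign (transpose w b \<circ> q) = sign (transpose w b) * sign q"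
      using q fin by (intro sign_compose permutation_swap_id) (auto intro: permutes_imp_permutation)
    ultimately show ?thesis
      using fin w by (auto simp: sign_swap_id)
  qed
  have "set_det M (insert w S) =
      (\<Sum>b\<in>insert w S. \<Sum>q | q permutes S. ?f (transpose w b \<circ> q))"
    unfolding set_det_def by (rule sum_over_permutations_insert[OF fin w])
  also have "\<dots> = (\<Sum>b\<in>insert w S. (if b = w then 1 else - 1) * M w b * ?c b)"
    by (intro sum.cong refl) (simp add: perm_term sum_distrib_left del: o_apply)
  also have "\<dots> = M w w * ?c w - (\<Sum>b\<in>S. M w b * ?c b)"
    using fin w by (subst sum.insert) (auto simp: sum_negf[symmetric] intro!: sum.cong)
  also have "?c w = set_det M S"
    by (simp add: set_det_def)
  finally show ?thesis .
qed

lemma set_det_isolated: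
  assumes "finite S" "w \<notin> S" "\<And>j. j \<in> S \<Longrightarrow> M w j = 0"
  shows "set_det M (insert w S) = M w w * set_det M S"
  using assms by (simp add: set_det_insert)

text \<open>In the expansion along row \<open>w\<close> only \<open>b = v\<close> survives. If then
  \<open>q v \<noteq> v\<close>, the index \<open>u\<close> with \<open>q u = v\<close> contributes
  the vanishing entry \<open>M u w\<close>, so only permutations of \<open>S - {v}\<close>
  remain.\<close>

lemma set_det_pendant:
  assumes fin: "finite S" and w: "w \<notin> S" and v: "v \<in> S"
    and row: "\<And>j. j \<in> S - {v} \<Longrightarrow> M w j = 0" and col: "\<And>i. i \<in> S - {v} \<Longrightarrow> M i w = 0"
  shows "set_det M (insert w S) = M w w * set_det M S - M w v * M v w * set_det M (S - {v})"
proof -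
  let ?g = "\<lambda>q. signof q * (\<Prod>i\<in>S. M i (transpose w v (q i))) :: 'a"
  have S: "S = insert v (S - {v})" and v': "v \<notin> S - {v}"
    using v by auto
  have "sum ?g {q. q permutes S} = sum ?g {q. q permutes (S - {v})}"
  proof (rule sum.mono_neutral_right)
    show "{q. q permutes (S - {v})} \<subseteq> {q. q permutes S}"
      by (auto elim: permutes_subset)
    show "\<forall>q\<in>{q. q permutes S} - {q. q permutes (S - {v})}. ?g q = 0"
    proof
      fix q assume q: "q \<in> {q. q permutes S} - {q. q permutes (S - {v})}"
      then have q1: "q permutes S" by simp
      have "q v \<noteq> v"
        using q permutes_superset[OF q1, of "S - {v}"] by auto
      obtain u where u: "u \<in> S" "q u = v"
        using permutes_image[OF q1] v by (metis imageE)
      with \<open>q v \<noteq> v\<close> have "M u w = 0" by (intro col) auto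
      with u have "M u (transpose w v (q u)) = 0" by simp
      then have "(\<Prod>i\<in>S. M i (transpose w v (q i))) = 0"
        by (intro prod_zero[OF fin]) (use u in blast)
      then show "?g q = 0" by simp
    qed
  qed (use fin in \<open>auto intro: finite_permutations\<close>)
  also have "\<dots> = M v w * set_det M (S - {v})"
  proof -
    have "?g q = M v w * (signof q * (\<Prod>i\<in>S - {v}. M i (q i)))" if q: "q permutes (S - {v})" for q
    proof -
      have "transpose w v (q i) = q i" if "i \<in> S - {v}" for i
        using permutes_in_image[OF q, of i] that w by (auto simp: transpose_def)
      then have "(\<Prod>i\<in>S - {v}. M i (transpose w v (q i))) = (\<Prod>i\<in>S - {v}. M i (q i))"
        by (intro prod.cong) auto
      moreover have "q v = v"
        using q by (simp add: permutes_not_in)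
      ultimately show ?thesis
        using fin by (subst (1) S, subst prod.insert) (auto simp: mult_ac)
    qed
    then show ?thesis
      by (simp add: set_det_def sum_distrib_left)
  qed
  finally have g: "sum ?g {q. q permutes S} = M v w * set_det M (S - {v})" .
  have "(\<Sum>b\<in>S. M w b * (\<Sum>q | q permutes S. signof q * (\<Prod>i\<in>S. M i (transpose w b (q i))))) =
      M w v * sum ?g {q. q permutes S}"
    using fin v row by (subst (1) S, subst sum.insert) (auto intro!: sum.neutral)
  then show ?thesis
    by (simp only: set_det_insert[OF fin w] g mult.assoc)
qed

text \<open>The characteristic polynomial of the subgraph induced on \<open>S\<close>, as the
  principal minor of xI - A.\<close>

definition graph_char_poly :: "(nat \<times> nat) set \<Rightarrow> nat set \<Rightarrow> real poly" where
  "graph_char_poly E S = set_det (\<lambda>i j. if i = j then [:0, 1:] else if (i, j) \<in> E then - 1 else 0) S"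

lemma graph_char_poly_empty [simp]: "graph_char_poly E {} = 1"
  by (simp add: graph_char_poly_def)

lemma graph_char_poly_isolated:
  assumes "finite S" "w \<notin> S" "\<And>j. j \<in> S \<Longrightarrow> (w, j) \<notin> E"
  shows "graph_char_poly E (insert w S) = [:0, 1:] * graph_char_poly E S"
  unfolding graph_char_poly_def using assms by (subst set_det_isolated) auto

lemma graph_char_poly_pendant:
  assumes "sym E" "finite S" "w \<notin> S" "v \<in> S" "\<And>j. j \<in> S \<Longrightarrow> (w, j) \<in> E \<longleftrightarrow> j = v"
  shows "graph_char_poly E (insert w S) =
    [:0, 1:] * graph_char_poly E S - graph_char_poly E (S - {v})"
proof -
  have "(j, w) \<in> E \<longleftrightarrow> j = v" if "j \<in> S" for j
    using assms(1) assms(5)[OF that] by (meson symE)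
  with assms show ?thesis
    unfolding graph_char_poly_def by (subst set_det_pendant[where v = v]) auto
qed

lemma char_poly_adjacency_mat:
  assumes V: "pverts G = {..<N}" and G: "pair_graph G"
  shows "char_poly (adjacency_mat G) = graph_char_poly (parcs G) {..<N}"
proof -
  have A: "adjacency_mat G = mat N N (\<lambda>(i, j). if (i, j) \<in> parcs G then 1 else 0)"
    by (auto simp: adjacency_mat_def Let_def V lessThan_atLeast0 intro!: cong_mat)
  have "(i, i) \<notin> parcs G" for i
    using pair_graphD(2)[OF G, of i i] by auto
  then have "char_poly_matrix (adjacency_mat G) =
      mat N N (\<lambda>(i, j). if i = j then [:0, 1:] else if (i, j) \<in> parcs G then - 1 else 0)"
    unfolding A char_poly_matrix_def by (intro eq_matI) (auto simp: one_pCons)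
  then show ?thesis
    by (simp add: char_poly_def det_eq_set_det graph_char_poly_def)
qed

lemma graph_char_poly_P2_component:
  assumes "sym E" "finite S" "w1 \<notin> S" "w2 \<notin> S" "w1 \<noteq> w2" "(w2, w1) \<in> E"
    "\<And>j. j \<in> S \<Longrightarrow> (w1, j) \<notin> E" "\<And>j. j \<in> S \<Longrightarrow> (w2, j) \<notin> E"
  shows "graph_char_poly E (insert w2 (insert w1 S)) = ([:0, 1:]\<^sup>2 - 1) * graph_char_poly E S"
proof -
  have "graph_char_poly E (insert w2 (insert w1 S)) =
      [:0, 1:] * graph_char_poly E (insert w1 S) - graph_char_poly E (insert w1 S - {w1})"
    using assms by (intro graph_char_poly_pendant) auto
  moreover have "graph_char_poly E (insert w1 S) = [:0, 1:] * graph_char_poly E S"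
    using assms by (intro graph_char_poly_isolated) auto
  moreover have "insert w1 S - {w1} = S"
    using assms by auto
  moreover have "x * (x * p) - p = (x\<^sup>2 - 1) * p" for x p :: "real poly"
    by (simp add: power2_eq_square algebra_simps)
  ultimately show ?thesis by (simp only:)
qed

text \<open>Two uses of the pendant-vertex rule: \<open>w2\<close> is a leaf at \<open>w1\<close>,
  and after its removal \<open>w1\<close> is a leaf at \<open>v\<close>.\<close>

lemma graph_char_poly_P2_pendant:
  assumes "sym E" "finite S" "w1 \<notin> S" "w2 \<notin> S" "w1 \<noteq> w2" "(w2, w1) \<in> E" "v \<in> S"
    "\<And>j. j \<in> S \<Longrightarrow> (w1, j) \<in> E \<longleftrightarrow> j = v" "\<And>j. j \<in> S \<Longrightarrow> (w2, j) \<notin> E"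
  shows "graph_char_poly E (insert w2 (insert w1 S)) =
    ([:0, 1:]\<^sup>2 - 1) * graph_char_poly E S - [:0, 1:] * graph_char_poly E (S - {v})"
proof -
  have "graph_char_poly E (insert w2 (insert w1 S)) =
      [:0, 1:] * graph_char_poly E (insert w1 S) - graph_char_poly E (insert w1 S - {w1})"
    using assms by (intro graph_char_poly_pendant) auto
  moreover have "graph_char_poly E (insert w1 S) =
      [:0, 1:] * graph_char_poly E S - graph_char_poly E (S - {v})"
    using assms by (intro graph_char_poly_pendant) auto
  moreover have "insert w1 S - {w1} = S"
    using assms by auto
  moreover have "x * (x * p - q) - p = (x\<^sup>2 - 1) * p - x * q" for x p q :: "real poly"
    by (simp add: power2_eq_square algebra_simps)
  ultimately show ?thesis by (simp only:)
qed

text \<open>The tail recursion lets the simplifier compute \<open>rec_poly c p q n\<close> for numerals \<open>n\<close> in \<open>n\<close> steps.\<close>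

primrec rec_poly :: "real \<Rightarrow> real poly \<Rightarrow> real poly \<Rightarrow> nat \<Rightarrow> real poly" where
  "rec_poly c p q 0 = p"
| "rec_poly c p q (Suc n) = rec_poly c q ([:0, 1:] * q + [:c:] * p) n"

lemma rec_poly_numeral [simp]:
  "rec_poly c p q (numeral k) = rec_poly c q ([:0, 1:] * q + [:c:] * p) (pred_numeral k)"
  by (simp add: numeral_eq_Suc)

lemma rec_poly_Suc_Suc:
  "rec_poly c p q (Suc (Suc n)) = [:0, 1:] * rec_poly c p q (Suc n) + [:c:] * rec_poly c p q n"
  by (induction n arbitrary: p q) simp_all

lemma rec_poly_Suc_0 [simp]: "rec_poly c p q (Suc 0) = q"
  by simp

declare rec_poly.simps(2) [simp del]

text \<open>For \<open>c = - 1\<close> these are characteristic polynomials (up to the factor \<open>(x\<^sup>2 - 1)\<^sup>2\<close> in the case of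
  \<open>tree_poly\<close>); \<open>c = 1\<close> gives their moduli on the imaginary axis. The index is the order of the graph
  minus \<open>8\<close> and minus \<open>4\<close>, respectively.\<close>

definition tree_poly :: "real \<Rightarrow> nat \<Rightarrow> real poly" where
  "tree_poly c = rec_poly c [:1, 0, 6 * c, 0, 1:] [:0, 5, 0, 6 * c, 0, 1:]"

definition star_poly :: "real \<Rightarrow> nat \<Rightarrow> real poly" where
  "star_poly c = rec_poly c [:1, 0, 3 * c, 0, 1:] [:0, 2, 0, 4 * c, 0, 1:]"

lemma tree_poly_simps [simp]:
  "tree_poly c 0 = [:1, 0, 6 * c, 0, 1:]"
  "tree_poly c (Suc 0) = [:0, 5, 0, 6 * c, 0, 1:]"
  "tree_poly c (Suc (Suc k)) = [:0, 1:] * tree_poly c (Suc k) + [:c:] * tree_poly c k"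
  unfolding tree_poly_def rec_poly_Suc_Suc by simp_all

lemma star_poly_simps [simp]:
  "star_poly c 0 = [:1, 0, 3 * c, 0, 1:]"
  "star_poly c (Suc 0) = [:0, 2, 0, 4 * c, 0, 1:]"
  "star_poly c (Suc (Suc k)) = [:0, 1:] * star_poly c (Suc k) + [:c:] * star_poly c k"
  unfolding star_poly_def rec_poly_Suc_Suc by simp_all

section \<open>Characteristic polynomials of the two trees\<close>

lemma arcs_attach_path:
  assumes "pverts G = {..<N}"
  shows "(a, b) \<in> parcs (attach_path v l G) \<longleftrightarrow> (a, b) \<in> parcs G \<or>
    l > 0 \<and> (a = v \<and> b = N \<or> b = v \<and> a = N) \<or>
    N \<le> a \<and> b = Suc a \<and> b < N + l \<or> N \<le> b \<and> a = Suc b \<and> a < N + l"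
proof -
  have edges: "(a, b) \<in> {(if i = 0 then v else N + i - 1, N + i) | i. i < l} \<longleftrightarrow>
      l > 0 \<and> a = v \<and> b = N \<or> N \<le> a \<and> b = Suc a \<and> b < N + l" (is "?L \<longleftrightarrow> ?R") for a b
  proof
    assume ?L
    then obtain i where "a = (if i = 0 then v else N + i - 1)" "b = N + i" "i < l" by blast
    then show ?R by (cases "i = 0") simp_all
  next
    assume ?R
    then have "a = (if b - N = 0 then v else N + (b - N) - 1) \<and> b = N + (b - N) \<and> b - N < l"
      by (elim disjE conjE) simp_all
    then show ?L by blast
  qed
  show ?thesis
    unfolding attach_path_def Let_def using assms
    by (simp only: pair_pre_digraph.simps Un_iff symcl_iff card_lessThan edges) blast
qed

text \<open>Vertex 0 is the centre, 1 and 2 form the arm of length 2, 3 is the leaf and the long arm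
  starts at 4. The initial segment of \<open>j + 4\<close> vertices thus induces the starlike tree
  with long arm \<open>j\<close>, and deleting its last vertex gives the recurrence.\<close>

lemma graph_char_poly_star:
  assumes E: "E = parcs (starlike_tree [2, 1, k])"
  shows "j \<le> k \<Longrightarrow> graph_char_poly E {..<j + 4} = star_poly (- 1) j"
proof -
  define R where "R a b \<longleftrightarrow> a = 0 \<and> (b = 1 \<or> b = 3 \<or> b = 4 \<and> 0 < k) \<or> a = 1 \<and> b = 2 \<or>
    4 \<le> a \<and> b = Suc a \<and> b < k + 4" for a b
  have edges: "(a, b) \<in> E \<longleftrightarrow> R a b \<or> R b a" for a b
  proof -
    let ?G0 = "path_graph 1" and ?G1 = "attach_path 0 2 (path_graph 1)"
    let ?G2 = "attach_path 0 1 ?G1"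
    have V: "pverts ?G0 = {..<1}" "pverts ?G1 = {..<3}" "pverts ?G2 = {..<4}"
      by (simp_all add: pverts_attach_path[of _ 1] pverts_attach_path[of _ 3])
    have none: "(a, b) \<notin> parcs ?G0"
      by (simp add: path_graph_def symcl_iff)
    have arcs: "(a, b) \<in> E \<longleftrightarrow> (a, b) \<in> parcs (attach_path 0 k ?G2)"
      by (simp add: E starlike_tree_def)
    note arcs = arcs[unfolded arcs_attach_path[OF V(1)] arcs_attach_path[OF V(2)] arcs_attach_path[OF V(3)]]
    show ?thesis
    proof
      show "R a b \<or> R b a" if "(a, b) \<in> E"
        using that none unfolding arcs R_def by (elim disjE conjE) simp_all
      show "(a, b) \<in> E" if "R a b \<or> R b a"
        using that unfolding arcs R_def by (elim disjE conjE) simp_all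
    qed
  qed
  have symE: "sym E"
    by (rule symI) (auto simp: edges)
  have P1: "graph_char_poly E {0} = [:0, 1:]"
    using graph_char_poly_isolated[of "{}" 0 E] by simp
  have P2: "graph_char_poly E {1, 2} = [:0, 1:]\<^sup>2 - 1"
    using graph_char_poly_P2_component[OF symE, of "{}" 1 2] by (simp add: edges R_def insert_commute)
  have "graph_char_poly E {0, 1, 2} = ([:0, 1:]\<^sup>2 - 1) * [:0, 1:] - [:0, 1:]"
    using graph_char_poly_P2_pendant[OF symE, of "{0}" 1 2 0] P1
    by (simp add: edges R_def insert_commute)
  then have "graph_char_poly E (insert 3 {0, 1, 2}) =
      [:0, 1:] * (([:0, 1:]\<^sup>2 - 1) * [:0, 1:] - [:0, 1:]) - ([:0, 1:]\<^sup>2 - 1)"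
    using P2 by (subst graph_char_poly_pendant[where v = 0]) (auto simp: symE edges R_def insert_Diff_if)
  moreover have "insert 3 {0, 1, 2} = {..<4 :: nat}"
    by auto
  ultimately have star0: "graph_char_poly E {..<4} = star_poly (- 1) 0"
    by (simp add: power2_eq_square one_pCons)
  show "j \<le> k \<Longrightarrow> graph_char_poly E {..<j + 4} = star_poly (- 1) j"
  proof (induction j rule: induct_nat_012)
    case 0
    show ?case by (simp only: add_0 star0)
  next
    \<comment> \<open>The first vertex of the long arm hangs on the centre, not on its predecessor
      3, so this step is not an instance of the general one.\<close>
    case 1
    have "graph_char_poly E (insert 4 {..<4}) =
        [:0, 1:] * graph_char_poly E {..<4} - graph_char_poly E ({..<4} - {0})"
      using 1 by (intro graph_char_poly_pendant symE) (auto simp: edges R_def)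
    moreover have "insert 4 {..<4} = {..<Suc 0 + 4}" "{..<4} - {0} = insert 3 {1, 2 :: nat}"
      by auto
    moreover have "graph_char_poly E (insert 3 {1, 2}) = [:0, 1:] * ([:0, 1:]\<^sup>2 - 1)"
      using P2 by (subst graph_char_poly_isolated) (auto simp: edges R_def)
    ultimately show ?case
      by (simp add: star0 power2_eq_square one_pCons)
  next
    case (ge2 j)
    have "graph_char_poly E (insert (j + 5) {..<j + 5}) = [:0, 1:] * graph_char_poly E {..<j + 5} -
        graph_char_poly E ({..<j + 5} - {j + 4})"
      using ge2.prems by (intro graph_char_poly_pendant symE) (auto simp: edges R_def)
    moreover have "insert (j + 5) {..<j + 5} = {..<Suc (Suc j) + 4}"
        "{..<j + 5} - {j + 4} = {..<j + 4}" "{..<j + 5} = {..<Suc j + 4}"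
      by auto
    moreover have "graph_char_poly E {..<Suc j + 4} = star_poly (- 1) (Suc j)"
        "graph_char_poly E {..<j + 4} = star_poly (- 1) j"
      using ge2 by simp_all
    ultimately show ?case
      by (simp only: star_poly_simps) simp
  qed
qed


text \<open>The path is 0, ..., \<open>p\<close>; the arms at 0 start at \<open>m\<close> and
  \<open>m + 2\<close>, those at \<open>p\<close> at \<open>m + 4\<close> and \<open>m + 6\<close>.
  The path is grown from the end carrying the first two arms, and the other two arms are attached
  last.\<close>

lemma graph_char_poly_tree:
  assumes E: "E = parcs (tree_T2222 (p + 9))" and p: "p > 0"
  shows "graph_char_poly E {..<p + 9} = [:- 1, 0, 1:]\<^sup>2 * tree_poly (- 1) (p + 1)"
proof -
  define m where "m = Suc p"
  define R where "R a b \<longleftrightarrow> b = Suc a \<and> b < m \<or> a = 0 \<and> (b = m \<or> b = m + 2) \<or>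
    a = p \<and> (b = m + 4 \<or> b = m + 6) \<or> b = Suc a \<and> (a = m \<or> a = m + 2 \<or> a = m + 4 \<or> a = m + 6)" for a b
  have edges: "(a, b) \<in> E \<longleftrightarrow> R a b \<or> R b a" for a b
  proof -
    let ?G0 = "path_graph m" and ?G1 = "attach_path 0 2 (path_graph m)"
    let ?G2 = "attach_path 0 2 ?G1"
    let ?G3 = "attach_path p 2 ?G2"
    have V: "pverts ?G0 = {..<m}" "pverts ?G1 = {..<m + 2}" "pverts ?G2 = {..<m + 4}" "pverts ?G3 = {..<m + 6}"
      by (simp_all add: pverts_attach_path[of _ m] pverts_attach_path[of _ "m + 2"]
          pverts_attach_path[of _ "m + 4"])
    have path: "(a, b) \<in> parcs ?G0 \<longleftrightarrow> b = Suc a \<and> b < m \<or> a = Suc b \<and> a < m"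
      by (auto simp: path_graph_def symcl_iff)
    have arcs: "(a, b) \<in> E \<longleftrightarrow> (a, b) \<in> parcs (attach_path p 2 ?G3)"
      by (simp add: E tree_T2222_def m_def)
    note arcs = arcs[unfolded arcs_attach_path[OF V(1)] arcs_attach_path[OF V(2)]
        arcs_attach_path[OF V(3)] arcs_attach_path[OF V(4)] path]
    show ?thesis
    proof
      show "R a b \<or> R b a" if "(a, b) \<in> E"
        using that unfolding arcs R_def by (elim disjE conjE) simp_all
      show "(a, b) \<in> E" if "R a b \<or> R b a"
        using that unfolding arcs R_def by (elim disjE conjE) simp_all
    qed
  qed
  have symE: "sym E"
    by (rule symI) (auto simp: edges)
  let ?X = "[:0, 1:] :: real poly"
  \<comment> \<open>The first \<open>j\<close> path vertices together with both arms at 0; for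
    \<open>j = 0\<close> these arms are two isolated copies of the path on two vertices.\<close>
  define S where "S j = {..<j} \<union> {m..<m + 4}" for j
  define s where "s j = graph_char_poly E (S j)" for j
  have single: "graph_char_poly E {0} = ?X"
    using graph_char_poly_isolated[of "{}" 0 E] by simp
  have m: "p < m"
    by (simp add: m_def)
  have P2: "graph_char_poly E (insert (m + 1) (insert m {})) = ?X\<^sup>2 - 1"
    by (subst graph_char_poly_P2_component[OF symE]) (simp_all add: edges R_def)
  have "graph_char_poly E (insert (m + 3) (insert (m + 2) (insert (m + 1) (insert m {})))) =
      (?X\<^sup>2 - 1) * (?X\<^sup>2 - 1)"
    using p m by (subst graph_char_poly_P2_component[OF symE]) (auto simp: P2[simplified] edges R_def)
  moreover have "insert (m + 3) (insert (m + 2) (insert (m + 1) (insert m {}))) = S 0"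
    by (auto simp: S_def)
  ultimately have s0: "s 0 = (?X\<^sup>2 - 1) * (?X\<^sup>2 - 1)"
    by (simp add: s_def)
  have P3: "graph_char_poly E (insert (m + 1) (insert m {0})) = (?X\<^sup>2 - 1) * ?X - ?X"
    using p by (subst graph_char_poly_P2_pendant[OF symE, where v = 0])
      (auto simp: single edges R_def m_def)
  have "graph_char_poly E (insert (m + 3) (insert (m + 2) (insert (m + 1) (insert m {0})))) =
      (?X\<^sup>2 - 1) * ((?X\<^sup>2 - 1) * ?X - ?X) -
      ?X * graph_char_poly E (insert (m + 1) (insert m {0}) - {0})"
    using p unfolding P3[symmetric]
    by (intro graph_char_poly_P2_pendant symE) (auto simp: edges R_def m_def)
  moreover have "insert (m + 1) (insert m {0}) - {0} = insert (m + 1) (insert m {})"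
    by (auto simp: m_def)
  moreover have "insert (m + 3) (insert (m + 2) (insert (m + 1) (insert m {0}))) = S 1"
    by (auto simp: S_def)
  ultimately have s1: "s 1 = (?X\<^sup>2 - 1) * ((?X\<^sup>2 - 1) * ?X - ?X) - ?X * (?X\<^sup>2 - 1)"
    by (simp only: s_def P2)
  have s_rec: "s (Suc (Suc j)) = ?X * s (Suc j) - s j" if "Suc j < m" for j
  proof -
    have "graph_char_poly E (insert (Suc j) (S (Suc j))) =
        ?X * graph_char_poly E (S (Suc j)) - graph_char_poly E (S (Suc j) - {j})"
      using that p by (intro graph_char_poly_pendant symE) (auto simp: S_def edges R_def m_def)
    moreover have "insert (Suc j) (S (Suc j)) = S (Suc (Suc j))" "S (Suc j) - {j} = S j"
      using that by (auto simp: S_def)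
    ultimately show ?thesis by (simp only: s_def)
  qed
  \<comment> \<open>This is the bracket left over when two arms are attached at the last vertex of
    \<open>S (Suc j)\<close>. It is linear in \<open>s\<close> and so inherits its recurrence; the
    base cases match indices 1 and 2 of \<open>tree_poly\<close>.\<close>
  have s_tree: "j < m \<Longrightarrow> (?X\<^sup>2 - 1) * s (Suc j) - 2 * ?X * s j = [:- 1, 0, 1:] * tree_poly (- 1) (j + 1)" for j
  proof (induction j rule: induct_nat_012)
    case 0
    show ?case using s0 s1 by (simp add: power2_eq_square one_pCons numeral_poly)
  next
    case 1
    then show ?case using s0 s1 s_rec[of 0] by (simp add: power2_eq_square one_pCons numeral_poly)
  next
    case (ge2 j)
    let ?P = "[:- 1, 0, 1:] :: real poly"
    have "(?X\<^sup>2 - 1) * s (Suc (Suc (Suc j))) - 2 * ?X * s (Suc (Suc j)) =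
        ?X * ((?X\<^sup>2 - 1) * s (Suc (Suc j)) - 2 * ?X * s (Suc j)) -
        ((?X\<^sup>2 - 1) * s (Suc j) - 2 * ?X * s j)"
    proof -
      have "(x\<^sup>2 - 1) * (x * v - u) - 2 * x * (x * u - t) = x * ((x\<^sup>2 - 1) * v - 2 * x * u) - ((x\<^sup>2 - 1) * u - 2 * x * t)"
        if "v = x * u - t" for x t u v :: "real poly"
        by (simp add: that algebra_simps power2_eq_square)
      then show ?thesis
        using ge2.prems by (simp only: s_rec)
    qed
    also have "\<dots> = ?X * (?P * tree_poly (- 1) (Suc (Suc j))) - ?P * tree_poly (- 1) (Suc j)"
      using ge2 by simp
    also have "\<dots> = ?P * (?X * tree_poly (- 1) (Suc (Suc j)) - tree_poly (- 1) (Suc j))"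
      by (simp only: right_diff_distrib mult.left_commute)
    finally show ?case by simp
  qed
  let ?G = "insert (m + 5) (insert (m + 4) (S m))"
  have "graph_char_poly E ?G = (?X\<^sup>2 - 1) * s m - ?X * graph_char_poly E (S m - {p})"
    unfolding s_def using p
    by (intro graph_char_poly_P2_pendant symE) (auto simp: S_def edges R_def m_def)
  moreover have "S m - {p} = S p"
    by (auto simp: S_def m_def)
  moreover have "graph_char_poly E (insert (m + 5) (insert (m + 4) (S p))) = (?X\<^sup>2 - 1) * s p"
    unfolding s_def using p
    by (intro graph_char_poly_P2_component symE) (auto simp: S_def edges R_def m_def)
  moreover have "?G - {p} = insert (m + 5) (insert (m + 4) (S p))"
    by (auto simp: S_def m_def)
  moreover have "graph_char_poly E (insert (m + 7) (insert (m + 6) ?G)) =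
      (?X\<^sup>2 - 1) * graph_char_poly E ?G - ?X * graph_char_poly E (?G - {p})"
    using p by (intro graph_char_poly_P2_pendant symE) (auto simp: S_def edges R_def m_def)
  moreover have "insert (m + 7) (insert (m + 6) ?G) = {..<p + 9}"
    by (auto simp: S_def m_def)
  ultimately have "graph_char_poly E {..<p + 9} =
      (?X\<^sup>2 - 1) * ((?X\<^sup>2 - 1) * s m - ?X * s p) - ?X * ((?X\<^sup>2 - 1) * s p)"
    by (simp only: s_def)
  also have "\<dots> = (?X\<^sup>2 - 1) * ((?X\<^sup>2 - 1) * s m - 2 * ?X * s p)"
  proof -
    have "q * (q * a - x * b) - x * (q * b) = q * (q * a - 2 * x * b)" for q x a b :: "real poly"
      by (simp add: algebra_simps)
    then show ?thesis .
  qed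
  also have "\<dots> = (?X\<^sup>2 - 1) * ([:- 1, 0, 1:] * tree_poly (- 1) (p + 1))"
    using s_tree[of p] by (simp only: m_def)
  also have "?X\<^sup>2 - 1 = [:- 1, 0, 1:]"
    by (simp add: power2_eq_square one_pCons)
  finally show ?thesis
    by (simp only: power2_eq_square mult.assoc)
qed

section \<open>Comparing sums of absolute values\<close>

text \<open>Coulson's formula in differential form: pi times the difference of the two sums is the
  total increase over the positive axis of a function whose derivative is the logarithm of the ratio
  of the products.\<close>

lemma sum_abs_mono_of_prod_mono:
  fixes as bs :: "real list"
  assumes len: "length as = length bs"
    and le: "\<And>y. y > 0 \<Longrightarrow> (\<Prod>a\<leftarrow>as. y\<^sup>2 + a\<^sup>2) \<le> (\<Prod>b\<leftarrow>bs. y\<^sup>2 + b\<^sup>2)"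
  shows "(\<Sum>a\<leftarrow>as. \<bar>a\<bar>) \<le> (\<Sum>b\<leftarrow>bs. \<bar>b\<bar>)"
proof -
  \<comment> \<open>\<open>F a\<close> is the antiderivative of \<open>ln (1 + a\<^sup>2 / y\<^sup>2)\<close> on \<open>{0<..}\<close> that vanishes at \<open>0\<close>, so that the
    integral in Coulson's formula reduces to limits. For \<open>a = 0\<close> it is \<open>0\<close> because \<open>y / 0 = 0\<close>.\<close>
  define F :: "real \<Rightarrow> real \<Rightarrow> real" where
    "F a y = y * ln (1 + a\<^sup>2 / y\<^sup>2) + 2 * a * arctan (y / a)" for a y
  have F_deriv: "(F a has_real_derivative ln (1 + a\<^sup>2 / y\<^sup>2)) (at y)" if "y > 0" for a y
  proof (cases "a = 0")
    case True
    then show ?thesis by (simp add: F_def[abs_def])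
  next
    case False
    have pos: "1 + a\<^sup>2 / y\<^sup>2 > 0" "y\<^sup>2 + a\<^sup>2 > 0"
      using that by (simp_all add: add_pos_nonneg)
    have d1: "((\<lambda>y. 1 + a\<^sup>2 / y\<^sup>2) has_real_derivative - 2 * a\<^sup>2 / y ^ 3) (at y)"
      using that by (auto intro!: derivative_eq_intros simp: field_simps power2_eq_square power3_eq_cube)
    have d2: "((\<lambda>y. y / a) has_real_derivative 1 / a) (at y)"
      using False by (auto intro!: derivative_eq_intros)
    have "(F a has_real_derivative 1 * ln (1 + a\<^sup>2 / y\<^sup>2)
        + 1 / (1 + a\<^sup>2 / y\<^sup>2) * (- 2 * a\<^sup>2 / y ^ 3) * y
        + 2 * a * (inverse (1 + (y / a)\<^sup>2) * (1 / a))) (at y)"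
      unfolding F_def[abs_def]
      by (intro DERIV_add DERIV_mult DERIV_cmult DERIV_ident DERIV_chain2[OF DERIV_ln_divide d1]
          DERIV_chain2[OF DERIV_arctan d2] pos)
    moreover have "1 / (1 + a\<^sup>2 / y\<^sup>2) * (- 2 * a\<^sup>2 / y ^ 3) * y = - 2 * a\<^sup>2 / (y\<^sup>2 + a\<^sup>2)"
      using that pos by (simp add: divide_simps power2_eq_square power3_eq_cube)
    moreover have "2 * a * (inverse (1 + (y / a)\<^sup>2) * (1 / a)) = 2 * a\<^sup>2 / (y\<^sup>2 + a\<^sup>2)"
      using False pos by (simp add: divide_simps power2_eq_square)
    ultimately show ?thesis by simp
  qed
  have F_0: "(F a \<longlongrightarrow> 0) (at_right 0)" for a
  proof (cases "a = 0")
    case True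
    then show ?thesis by (simp add: F_def[abs_def])
  next
    case False
    define c where "c = a\<^sup>2"
    have "c > 0" using False by (simp add: c_def)
    then have "((\<lambda>y. y * ln (1 + c / y\<^sup>2)) \<longlongrightarrow> 0) (at_right 0)"
      by real_asymp
    moreover have "((\<lambda>y. 2 * a * arctan (y / a)) \<longlongrightarrow> 2 * a * arctan (0 / a)) (at_right 0)"
      using False by (intro tendsto_intros)
    ultimately show ?thesis
      unfolding F_def[abs_def] c_def by (auto intro: tendsto_eq_intros)
  qed
  have F_top: "(F a \<longlongrightarrow> pi * \<bar>a\<bar>) at_top" for a
  proof -
    define c where "c = a\<^sup>2"
    consider "a = 0" | "a > 0" | "a < 0" by linarith
    then show ?thesis
    proof cases
      case 1
      then show ?thesis by (simp add: F_def[abs_def])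
    next
      case 2
      then have "c > 0" by (simp add: c_def)
      then have "((\<lambda>y. y * ln (1 + c / y\<^sup>2)) \<longlongrightarrow> 0) at_top"
        by real_asymp
      moreover have "((\<lambda>y. 2 * a * arctan (y / a)) \<longlongrightarrow> pi * a) at_top"
        using 2 by real_asymp
      ultimately show ?thesis
        using 2 unfolding F_def[abs_def] c_def by (auto intro: tendsto_eq_intros)
    next
      case 3
      then have "c > 0" by (simp add: c_def)
      then have "((\<lambda>y. y * ln (1 + c / y\<^sup>2)) \<longlongrightarrow> 0) at_top"
        by real_asymp
      moreover have "((\<lambda>y. 2 * a * arctan (y / a)) \<longlongrightarrow> - pi * a) at_top"
        using 3 by real_asymp
      ultimately show ?thesis
        using 3 unfolding F_def[abs_def] c_def by (auto intro: tendsto_eq_intros)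
    qed
  qed
  \<comment> \<open>The derivative of \<open>G cs\<close> is the logarithm of the product up to
    \<open>length cs * ln (y\<^sup>2)\<close>, a term that cancels in \<open>D\<close> because the
    lists have equal length.\<close>
  define G where "G cs y = (\<Sum>c\<leftarrow>cs. F c y)" for cs y
  have G_deriv: "(G cs has_real_derivative ln (\<Prod>c\<leftarrow>cs. y\<^sup>2 + c\<^sup>2) - length cs * ln (y\<^sup>2)) (at y)"
    if "y > 0" for cs y
  proof (induction cs)
    case Nil
    then show ?case by (simp add: G_def[abs_def])
  next
    case (Cons c cs)
    have "0 < (\<Prod>c\<leftarrow>cs. y\<^sup>2 + c\<^sup>2)"
      using that by (induction cs) (simp_all add: add_pos_nonneg)
    moreover have pos: "y\<^sup>2 + c\<^sup>2 > 0"
      using that by (simp add: add_pos_nonneg)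
    moreover have "ln (1 + c\<^sup>2 / y\<^sup>2) = ln (y\<^sup>2 + c\<^sup>2) - ln (y\<^sup>2)"
      using ln_div[of "y\<^sup>2 + c\<^sup>2" "y\<^sup>2"] that pos by (simp add: add_divide_distrib)
    ultimately have "ln (\<Prod>c\<leftarrow>c # cs. y\<^sup>2 + c\<^sup>2) - length (c # cs) * ln (y\<^sup>2) =
        ln (1 + c\<^sup>2 / y\<^sup>2) + (ln (\<Prod>c\<leftarrow>cs. y\<^sup>2 + c\<^sup>2) - length cs * ln (y\<^sup>2))"
      by (simp add: ln_mult_pos) (simp add: distrib_right)
    moreover have "G (c # cs) = (\<lambda>y. F c y + G cs y)"
      by (simp add: G_def[abs_def])
    ultimately show ?case
      using DERIV_add[OF F_deriv[OF that, of c] Cons.IH] by (simp only:)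
  qed
  have G_0: "(G cs \<longlongrightarrow> 0) (at_right 0)" for cs
    by (induction cs) (auto simp: G_def[abs_def] intro: tendsto_eq_intros F_0)
  have G_top: "(G cs \<longlongrightarrow> pi * (\<Sum>c\<leftarrow>cs. \<bar>c\<bar>)) at_top" for cs
    by (induction cs) (auto simp: G_def[abs_def] distrib_left intro: tendsto_eq_intros F_top)
  define D where "D y = G bs y - G as y" for y
  have mono: "D x \<le> D y" if "0 < x" "x \<le> y" for x y
  proof (rule DERIV_nonneg_imp_nondecreasing[OF that(2)])
    fix z assume "x \<le> z" "z \<le> y"
    with that have z: "z > 0" by simp
    have pos: "0 < (\<Prod>c\<leftarrow>as. z\<^sup>2 + c\<^sup>2)"
      using z by (induction as) (simp_all add: add_pos_nonneg)
    have "(D has_real_derivative ln (\<Prod>c\<leftarrow>bs. z\<^sup>2 + c\<^sup>2) - ln (\<Prod>c\<leftarrow>as. z\<^sup>2 + c\<^sup>2)) (at z)"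
      using DERIV_diff[OF G_deriv[OF z, of bs] G_deriv[OF z, of as]] len by (simp add: D_def[abs_def])
    moreover have "ln (\<Prod>c\<leftarrow>as. z\<^sup>2 + c\<^sup>2) \<le> ln (\<Prod>c\<leftarrow>bs. z\<^sup>2 + c\<^sup>2)"
      using le[OF z] pos by simp
    ultimately show "\<exists>d. (D has_real_derivative d) (at z) \<and> d \<ge> 0"
      by (intro exI conjI) auto
  qed
  \<comment> \<open>\<open>D\<close> is nondecreasing and tends to 0 at the left end of the positive
    axis.\<close>
  have D_nonneg: "0 \<le> D y" if "y > 0" for y
  proof (rule tendsto_upperbound)
    show "(D \<longlongrightarrow> 0) (at_right 0)"
      unfolding D_def[abs_def] by (auto intro: tendsto_eq_intros G_0)
    show "\<forall>\<^sub>F x in at_right 0. D x \<le> D y"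
      using that by (auto simp: eventually_at_right_field intro!: exI[of _ y] mono)
  qed simp
  have "(D \<longlongrightarrow> pi * (\<Sum>b\<leftarrow>bs. \<bar>b\<bar>) - pi * (\<Sum>a\<leftarrow>as. \<bar>a\<bar>)) at_top"
    unfolding D_def[abs_def] by (intro tendsto_intros G_top)
  then have "0 \<le> pi * (\<Sum>b\<leftarrow>bs. \<bar>b\<bar>) - pi * (\<Sum>a\<leftarrow>as. \<bar>a\<bar>)"
    by (rule tendsto_lowerbound)
      (use D_nonneg in \<open>auto intro: eventually_mono[OF eventually_gt_at_top[of 0]]\<close>)
  then show ?thesis by simp
qed

section \<open>Energy and roots\<close>

text \<open>The energy as a functional of the characteristic polynomial alone; it is additive over
  products, so known factors can be split off.\<close>

definition root_energy :: "real poly \<Rightarrow> real" where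
  "root_energy p = (\<Sum>x | poly p x = 0. real (Polynomial.order x p) * \<bar>x\<bar>)"

lemma graph_energy_eq_root_energy: "graph_energy G = root_energy (char_poly (adjacency_mat G))"
proof -
  have "adjacency_mat G \<in> carrier_mat (card (pverts G)) (card (pverts G))"
    by (simp add: adjacency_mat_def Let_def)
  then show ?thesis
    by (simp add: graph_energy_def root_energy_def eigenvalue_root_char_poly)
qed

lemma root_energy_mult:
  assumes "p \<noteq> 0" "q \<noteq> 0"
  shows "root_energy (p * q) = root_energy p + root_energy q"
proof -
  let ?R = "{x. poly (p * q) x = 0}"
  have fin: "finite ?R"
    using assms by (intro poly_roots_finite) simp
  have ext: "root_energy r = (\<Sum>x\<in>?R. real (Polynomial.order x r) * \<bar>x\<bar>)"
    if "{x. poly r x = 0} \<subseteq> ?R" "r \<noteq> 0" for r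
    unfolding root_energy_def using that fin by (intro sum.mono_neutral_left) (auto simp: order_root)
  have "root_energy p + root_energy q = (\<Sum>x\<in>?R. real (Polynomial.order x (p * q)) * \<bar>x\<bar>)"
    using assms by (subst (1 2) ext) (auto simp: order_mult sum.distrib[symmetric] algebra_simps intro!: sum.cong)
  then show ?thesis
    by (simp add: root_energy_def)
qed

lemma root_energy_linear: "root_energy [:- a, 1:] = \<bar>a\<bar>"
proof -
  have "{x. poly [:- a, 1:] x = 0} = {a}"
    by auto
  then show ?thesis
    using order_power_n_n[of a 1] by (simp add: root_energy_def)
qed

lemma root_energy_const: "p \<noteq> 0 \<Longrightarrow> degree p = 0 \<Longrightarrow> root_energy p = 0"
  by (auto elim!: degree_eq_zeroE simp: root_energy_def)

lemma root_energy_linear_factors: "root_energy (\<Prod>a\<leftarrow>as. [:- a, 1:]) = (\<Sum>a\<leftarrow>as. \<bar>a\<bar>)"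
proof (induction as)
  case Nil
  show ?case by (simp add: root_energy_const)
next
  case (Cons a as)
  have "(\<Prod>a\<leftarrow>as. [:- a, 1:]) \<noteq> (0 :: real poly)"
    unfolding prod_list_zero_iff by auto
  with Cons show ?case
    unfolding list.map prod_list.Cons by (subst root_energy_mult) (simp_all add: root_energy_linear)
qed

lemma root_energy_simple_roots:
  assumes "finite R" "p \<noteq> 0" "card R = degree p" "\<And>x. x \<in> R \<Longrightarrow> poly p x = 0"
  shows "root_energy p = (\<Sum>x\<in>R. \<bar>x\<bar>)"
  using assms
proof (induction R arbitrary: p rule: finite_induct)
  case empty
  then show ?case by (simp add: root_energy_const)
next
  case (insert a R)
  have "[:- a, 1:] dvd p"
    using insert.prems by (simp add: poly_eq_0_iff_dvd[symmetric])
  then obtain q where q: "p = [:- a, 1:] * q" ..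
  with insert.prems have "q \<noteq> 0" by auto
  have "degree p = Suc (degree q)"
    using \<open>q \<noteq> 0\<close> by (simp add: q degree_mult_eq del: mult_pCons_left)
  moreover have "poly q x = 0" if "x \<in> R" for x
    using insert.prems(3)[of x] that insert.hyps by (auto simp: q)
  ultimately have "root_energy q = (\<Sum>x\<in>R. \<bar>x\<bar>)"
    using insert.prems insert.hyps \<open>q \<noteq> 0\<close> by (intro insert.IH) auto
  then show ?case
    using insert.hyps \<open>q \<noteq> 0\<close>
    by (simp add: q root_energy_mult root_energy_linear del: mult_pCons_left)
qed

text \<open>The alternating signs give a root in each of the \<open>k\<close> intervals. With their
  negatives and 0 they exhaust the degree, so all roots are real, simple and bracketed.\<close>

lemma root_energy_bracket:
  fixes p :: "real poly"
  assumes deg: "degree p = 2 * k + 1" and odd: "\<And>x. poly p (- x) = - poly p x"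
    and u0: "0 < u 0" and u: "\<And>i. i < k \<Longrightarrow> u i < u (Suc i)"
    and sign: "\<And>i. i \<le> k \<Longrightarrow> (- 1) ^ i * poly p (u i) < 0"
  shows "2 * (\<Sum>i<k. u i) \<le> root_energy p" "root_energy p \<le> 2 * (\<Sum>i<k. u (Suc i))"
proof -
  have "\<exists>r>u i. r < u (Suc i) \<and> poly p r = 0" if "i < k" for i
  proof (rule poly_IVT)
    show "poly p (u i) * poly p (u (Suc i)) < 0"
      using sign[of i] sign[of "Suc i"] that by (cases "even i") (auto simp: mult_less_0_iff)
  qed (rule u[OF that])
  then obtain r where r: "\<And>i. i < k \<Longrightarrow> u i < r i \<and> r i < u (Suc i) \<and> poly p (r i) = 0"
    by metis
  have u_mono: "u i \<le> u j" if "i \<le> j" "j \<le> k" for i j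
    using that
  proof (induction j rule: dec_induct)
    case (step j)
    then show ?case using u[of j] by simp
  qed simp
  have r_pos: "r i > 0" if "i < k" for i
    using u_mono[of 0 i] u0 r[OF that] that by simp
  have r_mono: "r i < r j" if "i < j" "j < k" for i j
    using r[of i] r[of j] u_mono[of "Suc i" j] that by simp
  have inj: "inj_on r {..<k}"
    using r_mono by (intro inj_onI) (metis lessThan_iff less_irrefl linorder_neqE_nat)
  let ?A = "r ` {..<k}" and ?B = "(\<lambda>i. - r i) ` {..<k}"
  have "x > 0" if "x \<in> ?A" for x
    using that r_pos by auto
  moreover have "x < 0" if "x \<in> ?B" for x
    using that r_pos by auto
  ultimately have disj: "?A \<inter> ?B = {}" "0 \<notin> ?A \<union> ?B"
    by fastforce+
  have inj': "inj_on (\<lambda>i. - r i) {..<k}"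
    using inj by (auto simp: inj_on_def)
  have "card (insert 0 (?A \<union> ?B)) = degree p"
    using disj by (simp add: card_Un_disjoint card_image inj inj' deg)
  moreover have "poly p 0 = 0"
    using odd[of 0] by simp
  ultimately have "root_energy p = (\<Sum>x\<in>insert 0 (?A \<union> ?B). \<bar>x\<bar>)"
    using deg r odd by (intro root_energy_simple_roots) auto
  also have "\<dots> = (\<Sum>x\<in>?A. \<bar>x\<bar>) + (\<Sum>x\<in>?B. \<bar>x\<bar>)"
    using disj by (simp add: sum.union_disjoint)
  also have "\<dots> = 2 * (\<Sum>i<k. \<bar>r i\<bar>)"
    by (simp add: sum.reindex inj inj')
  also have "(\<Sum>i<k. \<bar>r i\<bar>) = (\<Sum>i<k. r i)"
    using r_pos by (intro sum.cong) (simp_all add: less_imp_le)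
  finally have "root_energy p = 2 * (\<Sum>i<k. r i)" .
  moreover have "(\<Sum>i<k. u i) \<le> (\<Sum>i<k. r i)" "(\<Sum>i<k. r i) \<le> (\<Sum>i<k. u (Suc i))"
    using r by (auto intro!: sum_mono simp: less_imp_le)
  ultimately show "2 * (\<Sum>i<k. u i) \<le> root_energy p" "root_energy p \<le> 2 * (\<Sum>i<k. u (Suc i))"
    by simp_all
qed

section \<open>Real spectrum of symmetric matrices and the resulting root lists\<close>

lemma real_symmetric_eigenvalue_real:
  fixes A :: "complex mat"
  assumes A: "A \<in> carrier_mat n n" and real: "\<And>i j. i < n \<Longrightarrow> j < n \<Longrightarrow> cnj (A $$ (i, j)) = A $$ (i, j)"
    and sym: "\<And>i j. i < n \<Longrightarrow> j < n \<Longrightarrow> A $$ (i, j) = A $$ (j, i)"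
    and ev: "eigenvalue A z"
  shows "z \<in> \<real>"
proof -
  from ev A obtain v where v: "v \<in> carrier_vec n" "v \<noteq> 0\<^sub>v n" and eq: "A *\<^sub>v v = z \<cdot>\<^sub>v v"
    by (auto simp: eigenvalue_def eigenvector_def)
  have row: "(\<Sum>j<n. A $$ (i, j) * v $ j) = z * v $ i" if "i < n" for i
    using arg_cong[OF eq, of "\<lambda>w. w $ i"] A v that
    by (simp add: scalar_prod_def lessThan_atLeast0 row_def)
  \<comment> \<open>The squared norm of \<open>v\<close>. Moving \<open>A\<close> across the
    Hermitian form turns \<open>z\<close> into its conjugate, and \<open>N\<close> is
    nonzero.\<close>
  define N where "N = (\<Sum>i<n. v $ i * cnj (v $ i))"
  have "z * N = (\<Sum>i<n. z * v $ i * cnj (v $ i))"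
    by (simp add: N_def sum_distrib_left mult.assoc)
  also have "\<dots> = (\<Sum>i<n. (\<Sum>j<n. A $$ (i, j) * v $ j) * cnj (v $ i))"
    by (simp add: row)
  also have "\<dots> = (\<Sum>j<n. \<Sum>i<n. A $$ (i, j) * v $ j * cnj (v $ i))"
    by (subst sum.swap) (simp add: sum_distrib_right)
  also have "\<dots> = (\<Sum>j<n. v $ j * cnj (\<Sum>i<n. A $$ (j, i) * v $ i))"
    by (auto simp: cnj_sum sum_distrib_left real sym mult_ac intro!: sum.cong)
  also have "\<dots> = (\<Sum>j<n. v $ j * cnj (z * v $ j))"
    by (simp add: row del: cnj_sum)
  also have "\<dots> = cnj z * N"
    by (simp add: N_def sum_distrib_left mult_ac)
  finally have "z * N = cnj z * N" .
  moreover have "N \<noteq> 0"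
  proof -
    have N: "N = of_real (\<Sum>i<n. (cmod (v $ i))\<^sup>2)"
      by (simp add: N_def complex_norm_square[symmetric] del: of_real_power)
    obtain i where "i < n" "v $ i \<noteq> 0"
      using v by (metis carrier_vecD eq_vecI index_zero_vec)
    then have "(\<Sum>i<n. (cmod (v $ i))\<^sup>2) > 0"
      by (intro sum_pos2[of _ i]) auto
    then show ?thesis by (simp only: N of_real_eq_0_iff)
  qed
  ultimately show ?thesis
    by (simp add: Reals_cnj_iff)
qed

text \<open>The polynomial splits over the complex numbers with real roots only; injectivity of the
  embedding brings the factorization back to the reals.\<close>

lemma symmetric_char_poly_splits:
  fixes A :: "real mat"
  assumes A: "A \<in> carrier_mat n n" and sym: "\<And>i j. i < n \<Longrightarrow> j < n \<Longrightarrow> A $$ (i, j) = A $$ (j, i)"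
  shows "\<exists>as. char_poly A = (\<Prod>a\<leftarrow>as. [:- a, 1:]) \<and> length as = n"
proof -
  interpret h: map_poly_inj_idom_hom complex_of_real ..
  let ?C = "map_mat complex_of_real A"
  have C: "?C \<in> carrier_mat n n" using A by simp
  obtain zs where zs: "char_poly ?C = (\<Prod>z\<leftarrow>zs. [:- z, 1:])" "length zs = n"
    using char_poly_factorized[OF C] by blast
  have "z \<in> \<real>" if "z \<in> set zs" for z
  proof (rule real_symmetric_eigenvalue_real[OF C])
    have "poly (char_poly ?C) z = 0"
      unfolding zs using that by (simp add: poly_prod_list prod_list_zero_iff image_iff)
    then show "eigenvalue ?C z"
      using eigenvalue_root_char_poly[OF C] by simp
  qed (use A sym in auto)
  then have "map (\<lambda>z. of_real (Re z)) zs = zs"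
    by (intro map_idI) simp
  then have "char_poly ?C = (\<Prod>a\<leftarrow>map Re zs. [:- of_real a, 1:])"
    unfolding zs(1) by (metis (no_types, lifting) map_map comp_def map_eq_conv)
  also have "\<dots> = map_poly of_real (\<Prod>a\<leftarrow>map Re zs. [:- a, 1:])"
    by (induction zs) (simp_all add: hom_distribs del: mult_pCons_left)
  finally have "map_poly complex_of_real (char_poly A) = map_poly of_real (\<Prod>a\<leftarrow>map Re zs. [:- a, 1:])"
    by (simp add: of_real_hom.char_poly_hom[OF A])
  then have "char_poly A = (\<Prod>a\<leftarrow>map Re zs. [:- a, 1:])"
    by (rule h.injectivity)
  with zs(2) show ?thesis by (intro exI[of _ "map Re zs"]) simp
qed

text \<open>Supplies the input of \<open>sum_abs_mono_of_prod_mono\<close>: for a real root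
  \<open>a\<close>, the squared modulus of \<open>\<i> * y - a\<close> is
  \<open>y\<^sup>2 + a\<^sup>2\<close>.\<close>

lemma graph_energy_roots:
  assumes V: "pverts G = {..<N}" and G: "pair_graph G"
  obtains as where "length as = N" "graph_energy G = (\<Sum>a\<leftarrow>as. \<bar>a\<bar>)"
    "\<And>y. (\<Prod>a\<leftarrow>as. y\<^sup>2 + a\<^sup>2) =
      (cmod (poly (map_poly of_real (graph_char_poly (parcs G) {..<N})) (\<i> * of_real y)))\<^sup>2"
proof -
  interpret h: map_poly_inj_idom_hom complex_of_real ..
  have A: "adjacency_mat G \<in> carrier_mat N N"
    by (simp add: adjacency_mat_def Let_def V)
  have "adjacency_mat G $$ (i, j) = adjacency_mat G $$ (j, i)" if "i < N" "j < N" for i j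
    using that pair_graphD(1)[OF G]
    by (auto simp: adjacency_mat_def Let_def V dest: symD)
  then obtain as where as: "char_poly (adjacency_mat G) = (\<Prod>a\<leftarrow>as. [:- a, 1:])" "length as = N"
    using symmetric_char_poly_splits[OF A] by blast
  have "(\<Prod>a\<leftarrow>as. y\<^sup>2 + a\<^sup>2) =
      (cmod (poly (map_poly of_real (\<Prod>a\<leftarrow>as. [:- a, 1:])) (\<i> * of_real y)))\<^sup>2" for y
  proof (induction as)
    case (Cons a as)
    have "(cmod (\<i> * of_real y - of_real a))\<^sup>2 = y\<^sup>2 + a\<^sup>2"
      by (simp add: cmod_power2)
    with Cons show ?case
      by (simp add: hom_distribs norm_mult power_mult_distrib del: mult_pCons_left)
  qed simp
  with as that show ?thesis
    by (simp add: graph_energy_eq_root_energy root_energy_linear_factors char_poly_adjacency_mat[OF V G, symmetric])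
qed

section \<open>Values on the imaginary axis and the comparison of the recurrences\<close>

lemma rec_poly_imaginary:
  fixes y :: real
  defines "ev p \<equiv> poly (map_poly complex_of_real p) (\<i> * of_real y)"
  assumes "ev p = of_real (poly p' y)" "ev q = \<i> * of_real (poly q' y)"
  shows "ev (rec_poly (- 1) p q k) = \<i> ^ k * of_real (poly (rec_poly 1 p' q' k) y)"
proof (induction k rule: induct_nat_012)
  case (ge2 k)
  interpret h: map_poly_inj_idom_hom complex_of_real ..
  \<comment> \<open>Substituting f_k = \<i>^k g_k turns x f_(k+1) - f_k into \<i>^(k+2) (y g_(k+1) +
    g_k), so the sign of \<open>c\<close> flips.\<close>
  have "ev (rec_poly (- 1) p q (Suc (Suc k))) =
      \<i> * of_real y * ev (rec_poly (- 1) p q (Suc k)) - ev (rec_poly (- 1) p q k)"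
    unfolding rec_poly_Suc_Suc by (simp add: ev_def hom_distribs)
  also have "\<dots> = \<i> ^ Suc (Suc k) * of_real (poly (rec_poly 1 p' q' (Suc (Suc k))) y)"
    unfolding ge2 rec_poly_Suc_Suc by (simp add: algebra_simps)
  finally show ?case .
qed (use assms in \<open>simp_all\<close>)

lemma tree_poly_imaginary:
  "poly (map_poly complex_of_real (tree_poly (- 1) k)) (\<i> * of_real y) =
    \<i> ^ k * of_real (poly (tree_poly 1 k) y)"
  unfolding tree_poly_def
  by (rule rec_poly_imaginary) (simp_all add: map_poly_pCons algebra_simps)

lemma star_poly_imaginary:
  "poly (map_poly complex_of_real (star_poly (- 1) k)) (\<i> * of_real y) =
    \<i> ^ k * of_real (poly (star_poly 1 k) y)"
  unfolding star_poly_def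
  by (rule rec_poly_imaginary) (simp_all add: map_poly_pCons algebra_simps)

lemma poly_rec_poly_nonneg:
  fixes y :: real
  assumes "0 \<le> y" "0 \<le> c" "0 \<le> poly p y" "0 \<le> poly q y"
  shows "0 \<le> poly (rec_poly c p q n) y"
proof (induction n rule: induct_nat_012)
  case (ge2 n)
  with assms show ?case unfolding rec_poly_Suc_Suc by simp
qed (use assms in simp_all)

lemma poly_pCons_nonneg:
  fixes y :: real
  shows "0 \<le> a \<Longrightarrow> 0 \<le> y \<Longrightarrow> 0 \<le> poly p y \<Longrightarrow> 0 \<le> poly (pCons a p) y"
  by simp

text \<open>Without the last factors the inequality fails for \<open>k = 0\<close> and large \<open>y\<close>; the constant is chosen
  such that for \<open>k = 0\<close> the difference of the two sides has no negative coefficient.\<close>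

lemma tree_poly_star_poly_le:
  fixes y :: real
  assumes "0 \<le> y"
  shows "poly (tree_poly 1 (k + 14)) y * poly (star_poly 1 19) y * (y\<^sup>2 + 1) \<le>
    poly (tree_poly 1 15) y * poly (star_poly 1 (k + 18)) y * (y\<^sup>2 + (20001 / 20000)\<^sup>2)"
proof -
  \<comment> \<open>Indices \<open>k + 14\<close> and \<open>k + 18\<close> both belong to order
    \<open>k + 22\<close>, and 15 and 19 to order 23.\<close>
  define D where "D k = poly (tree_poly 1 15) y * poly (star_poly 1 (k + 18)) y * (y\<^sup>2 + (20001 / 20000)\<^sup>2)
    - poly (tree_poly 1 (k + 14)) y * poly (star_poly 1 19) y * (y\<^sup>2 + 1)" for k
  have "0 \<le> D k"
  proof (induction k rule: induct_nat_012)
    case 0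
    have "D 0 = poly (tree_poly 1 15 * star_poly 1 18 * [:(20001 / 20000)\<^sup>2, 0, 1:]
        - tree_poly 1 14 * star_poly 1 19 * [:1, 0, 1:]) y"
      by (simp add: D_def power2_eq_square algebra_simps)
    also have "0 \<le> \<dots>"
      by (simp add: tree_poly_def star_poly_def power2_eq_square del: poly_pCons)
         (intro poly_pCons_nonneg assms; simp)
    finally show ?case .
  next
    case 1
    \<comment> \<open>At order 23 both sides agree except for the last factor, where the constant
      exceeds 1.\<close>
    have "0 \<le> poly (tree_poly 1 15) y" "0 \<le> poly (star_poly 1 19) y"
      unfolding tree_poly_def star_poly_def using assms by (intro poly_rec_poly_nonneg; simp)+
    then have "poly (tree_poly 1 15) y * poly (star_poly 1 19) y * (y\<^sup>2 + 1) \<le>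
        poly (tree_poly 1 15) y * poly (star_poly 1 19) y * (y\<^sup>2 + (20001 / 20000)\<^sup>2)"
      by (intro mult_left_mono mult_nonneg_nonneg) (simp_all add: power2_eq_square)
    then show ?case by (simp add: D_def)
  next
    case (ge2 k)
    \<comment> \<open>For fixed \<open>y\<close>, \<open>D\<close> is a combination of two sequences
      with the same recurrence, whose coefficients \<open>y\<close> and 1 are nonnegative.\<close>
    have "D (Suc (Suc k)) = y * D (Suc k) + D k"
      by (simp only: D_def add_Suc tree_poly_simps star_poly_simps poly_add poly_mult poly_pCons poly_0)
        (simp add: algebra_simps)
    with ge2 assms show ?case by simp
  qed
  then show ?thesis by (simp add: D_def)
qed

section \<open>The case of order 23 and the general case\<close>

text \<open>The fractions in the next two lemmas approximate the positive roots with an error of less than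
  \<open>7 / 10\<^sup>6\<close>, from above and from below, respectively.\<close>

lemma root_energy_tree_poly_15: "root_energy (tree_poly (- 1) 15) \<le>
  2 * (122/453 + 224/393 + 457/512 + 643/532 + 904/605 + 362/209 + 2669/1398 + 427/208 + 860/417)"
proof -
  define p where "p = tree_poly (- 1) 15"
  define u :: "nat \<Rightarrow> real" where
    \<comment> \<open>The entry 1/10 only opens the first bracket, below the smallest positive root;
      the other entries are the upper bounds.\<close>
    "u = (!) [1/10, 122/453, 224/393, 457/512, 643/532, 904/605, 362/209, 2669/1398, 427/208, 860/417]"
  have p: "p = [:0, - 12, 0, 244, 0, - 1268, 0, 2766, 0, - 3112, 0, 1992, 0, - 754, 0, 167, 0, - 20, 0, 1:]"
    by (simp add: p_def tree_poly_def)
  have "root_energy p \<le> 2 * (\<Sum>i<9. u (Suc i))"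
  proof (rule root_energy_bracket)
    show "degree p = 2 * 9 + 1" by (simp add: p)
    show "poly p (- x) = - poly p x" for x by (simp add: p algebra_simps)
    show "u i < u (Suc i)" if "i < 9" for i
    proof -
      have "i \<in> {0, 1, 2, 3, 4, 5, 6, 7, 8}"
        using that by (simp add: numeral_eq_Suc less_Suc_eq)
      then show ?thesis
        by (elim insertE emptyE) (simp_all add: u_def)
    qed
    show "(- 1) ^ i * poly p (u i) < 0" if "i \<le> 9" for i
    proof -
      have "i \<in> {0, 1, 2, 3, 4, 5, 6, 7, 8, 9}"
        using that by (simp add: numeral_eq_Suc le_Suc_eq)
      then show ?thesis
        by (elim insertE emptyE) (simp_all add: p u_def)
    qed
  qed (simp add: u_def)
  then show ?thesis
    by (simp add: p_def u_def eval_nat_numeral)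
qed

lemma root_energy_star_poly_19: "2 * (256/907 + 287/535 + 233/323 + 367/398 + 2457/2122 + 3918/2833 +
  704/445 + 423/242 + 1831/976 + 842/429 + 1444/715) \<le> root_energy (star_poly (- 1) 19)"
proof -
  define p where "p = star_poly (- 1) 19"
  define u :: "nat \<Rightarrow> real" where
    \<comment> \<open>The last entry 3 only closes the bracket of the largest root; the other
      entries are the lower bounds.\<close>
    "u = (!) [256/907, 287/535, 233/323, 367/398, 2457/2122, 3918/2833, 704/445, 423/242, 1831/976,
      842/429, 1444/715, 3]"
  have p: "p = [:0, - 11, 0, 241, 0, - 1672, 0, 5511, 0, - 10153, 0, 11375, 0, - 8113, 0, 3756, 0,
      - 1123, 0, 209, 0, - 22, 0, 1:]"
    by (simp add: p_def star_poly_def)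
  have "2 * (\<Sum>i<11. u i) \<le> root_energy p"
  proof (rule root_energy_bracket)
    show "degree p = 2 * 11 + 1" by (simp add: p)
    show "poly p (- x) = - poly p x" for x by (simp add: p algebra_simps)
    show "u i < u (Suc i)" if "i < 11" for i
    proof -
      have "i \<in> {0, 1, 2, 3, 4, 5, 6, 7, 8, 9, 10}"
        using that by (simp add: numeral_eq_Suc less_Suc_eq)
      then show ?thesis
        by (elim insertE emptyE) (simp_all add: u_def)
    qed
    show "(- 1) ^ i * poly p (u i) < 0" if "i \<le> 11" for i
    proof -
      have "i \<in> {0, 1, 2, 3, 4, 5, 6, 7, 8, 9, 10, 11}"
        using that by (simp add: numeral_eq_Suc le_Suc_eq)
      then show ?thesis
        by (elim insertE emptyE) (simp_all add: p u_def)
    qed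
  qed (simp add: u_def)
  then show ?thesis
    by (simp add: p_def u_def eval_nat_numeral)
qed

lemma graph_char_poly_tree_T2222:
  assumes "n \<ge> 10"
  shows "graph_char_poly (parcs (tree_T2222 n)) {..<n} = [:- 1, 0, 1:]\<^sup>2 * tree_poly (- 1) (n - 8)"
proof -
  have "n - 9 + 9 = n" "n - 9 + 1 = n - 8"
    using assms by simp_all
  then show ?thesis
    using graph_char_poly_tree[OF refl, of "n - 9"] assms by (simp only:)
qed

lemma graph_char_poly_starlike_tree:
  assumes "n \<ge> 4"
  shows "graph_char_poly (parcs (starlike_tree [2, 1, n - 4])) {..<n} = star_poly (- 1) (n - 4)"
  using graph_char_poly_star[OF refl, of "n - 4" "n - 4"] assms by simp

text \<open>The factor (x^2 - 1)^2 has the roots 1 and -1 twice each, which accounts for the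
  4.\<close>

lemma graph_energy_tree_T2222_23:
  "graph_energy (tree_T2222 23) = 4 + root_energy (tree_poly (- 1) 15)"
proof -
  have factor: "[:- 1, 0, 1:] = [:- 1, 1:] * [:- (- 1), 1 :: real:]"
    by simp
  have "root_energy [:- 1, 0, 1:] = 2"
    unfolding factor by (subst root_energy_mult) (simp_all only: root_energy_linear, simp_all)
  moreover have "tree_poly (- 1) 15 \<noteq> 0"
    by (simp add: tree_poly_def)
  ultimately have "root_energy ([:- 1, 0, 1:]\<^sup>2 * tree_poly (- 1) 15) = 4 + root_energy (tree_poly (- 1) 15)"
    unfolding power2_eq_square by (subst root_energy_mult; simp add: root_energy_mult del: mult_pCons_left mult_pCons_right)+
  then show ?thesis
    using graph_char_poly_tree_T2222[of 23] tree_T2222_wf[of 23]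
    by (simp add: graph_energy_eq_root_energy char_poly_adjacency_mat)
qed

theorem theorem5p4:
  fixes n :: nat
  assumes "n \<ge> 22"
  shows "graph_energy (tree_T2222 n) < graph_energy (starlike_tree [2, 1, n - 4])"
proof -
  let ?T = "\<lambda>k y. poly (tree_poly 1 k) (y :: real)" and ?E = "\<lambda>k y. poly (star_poly 1 k) (y :: real)"
  have tree: "\<exists>as. length as = k \<and> graph_energy (tree_T2222 k) = (\<Sum>a\<leftarrow>as. \<bar>a\<bar>) \<and>
      (\<forall>y. (\<Prod>a\<leftarrow>as. y\<^sup>2 + a\<^sup>2) = ((y\<^sup>2 + 1)\<^sup>2 * ?T (k - 8) y)\<^sup>2)" if "k \<ge> 22" for k
  proof -
    interpret h: map_poly_inj_idom_hom complex_of_real ..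
    have quadratic: "poly (map_poly complex_of_real [:- 1, 0, 1:]) (\<i> * of_real y) = of_real (- (y\<^sup>2 + 1))" for y
      by (simp add: map_poly_pCons power2_eq_square algebra_simps)
    have cmod: "(cmod ((of_real (- c))\<^sup>2 * (\<i> ^ l * of_real t)))\<^sup>2 = (c\<^sup>2 * t)\<^sup>2" for c t l
      by (simp add: norm_mult norm_power power_mult_distrib)
    have norm: "(cmod (poly (map_poly of_real ([:- 1, 0, 1:]\<^sup>2 * tree_poly (- 1) (k - 8))) (\<i> * of_real y)))\<^sup>2 =
        ((y\<^sup>2 + 1)\<^sup>2 * ?T (k - 8) y)\<^sup>2" for y
      by (simp only: h.hom_mult h.hom_power poly_mult poly_power quadratic tree_poly_imaginary cmod)
    have "pverts (tree_T2222 k) = {..<k}" "pair_graph (tree_T2222 k)"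
      using tree_T2222_wf[of k] that by simp_all
    then obtain as where "length as = k" "graph_energy (tree_T2222 k) = (\<Sum>a\<leftarrow>as. \<bar>a\<bar>)"
      "\<And>y. (\<Prod>a\<leftarrow>as. y\<^sup>2 + a\<^sup>2) = (cmod (poly (map_poly of_real
        (graph_char_poly (parcs (tree_T2222 k)) {..<k})) (\<i> * of_real y)))\<^sup>2"
      by (rule graph_energy_roots) blast
    moreover have "k \<ge> 10" using that by simp
    ultimately show ?thesis
      by (intro exI[of _ as] conjI allI) (simp_all only: graph_char_poly_tree_T2222 norm)
  qed
  have star: "\<exists>as. length as = k \<and> graph_energy (starlike_tree [2, 1, k - 4]) = (\<Sum>a\<leftarrow>as. \<bar>a\<bar>) \<and>
      (\<forall>y. (\<Prod>a\<leftarrow>as. y\<^sup>2 + a\<^sup>2) = (?E (k - 4) y)\<^sup>2)" if "k \<ge> 22" for k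
  proof -
    have norm: "(cmod (poly (map_poly of_real (star_poly (- 1) (k - 4))) (\<i> * of_real y)))\<^sup>2 =
        (?E (k - 4) y)\<^sup>2" for y
      by (simp add: norm_mult norm_power star_poly_imaginary)
    have "pverts (starlike_tree [2, 1, k - 4]) = {..<k}" "pair_graph (starlike_tree [2, 1, k - 4])"
      using starlike_tree_wf[of "[2, 1, k - 4]"] that by simp_all
    then obtain as where "length as = k" "graph_energy (starlike_tree [2, 1, k - 4]) = (\<Sum>a\<leftarrow>as. \<bar>a\<bar>)"
      "\<And>y. (\<Prod>a\<leftarrow>as. y\<^sup>2 + a\<^sup>2) = (cmod (poly (map_poly of_real
        (graph_char_poly (parcs (starlike_tree [2, 1, k - 4])) {..<k})) (\<i> * of_real y)))\<^sup>2"
      by (rule graph_energy_roots) blast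
    moreover have "k \<ge> 4" using that by simp
    ultimately show ?thesis
      by (intro exI[of _ as] conjI allI) (simp_all only: graph_char_poly_starlike_tree norm)
  qed
  obtain ts where ts: "length ts = n" "graph_energy (tree_T2222 n) = (\<Sum>a\<leftarrow>ts. \<bar>a\<bar>)"
      "\<And>y. (\<Prod>a\<leftarrow>ts. y\<^sup>2 + a\<^sup>2) = ((y\<^sup>2 + 1)\<^sup>2 * ?T (n - 8) y)\<^sup>2"
    using tree[OF assms] by blast
  obtain ts' where ts': "length ts' = 23" "graph_energy (tree_T2222 23) = (\<Sum>a\<leftarrow>ts'. \<bar>a\<bar>)"
      "\<And>y. (\<Prod>a\<leftarrow>ts'. y\<^sup>2 + a\<^sup>2) = ((y\<^sup>2 + 1)\<^sup>2 * ?T 15 y)\<^sup>2"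
    using tree[of 23] by auto
  obtain es where es: "length es = n" "graph_energy (starlike_tree [2, 1, n - 4]) = (\<Sum>a\<leftarrow>es. \<bar>a\<bar>)"
      "\<And>y. (\<Prod>a\<leftarrow>es. y\<^sup>2 + a\<^sup>2) = (?E (n - 4) y)\<^sup>2"
    using star[OF assms] by blast
  obtain es' where es': "length es' = 23" "graph_energy (starlike_tree [2, 1, 19]) = (\<Sum>a\<leftarrow>es'. \<bar>a\<bar>)"
      "\<And>y. (\<Prod>a\<leftarrow>es'. y\<^sup>2 + a\<^sup>2) = (?E 19 y)\<^sup>2"
    using star[of 23] by auto
  let ?r = "20001 / 20000 :: real"
  \<comment> \<open>Concatenating root lists multiplies the products. These are squared moduli, so 1
    and \<open>?r\<close> enter twice, giving the squares of the two correction factors.\<close>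
  have "(\<Sum>a\<leftarrow>ts @ es' @ [1, 1]. \<bar>a\<bar>) \<le> (\<Sum>a\<leftarrow>ts' @ es @ [?r, ?r]. \<bar>a\<bar>)"
  proof (rule sum_abs_mono_of_prod_mono)
    fix y :: real assume y: "y > 0"
    have "?T (n - 8) y * ?E 19 y * (y\<^sup>2 + 1) \<le> ?T 15 y * ?E (n - 4) y * (y\<^sup>2 + ?r\<^sup>2)"
      using tree_poly_star_poly_le[of y "n - 22"] assms y by (simp del: power_divide)
    moreover have "0 \<le> ?T (n - 8) y" "0 \<le> ?E 19 y"
      unfolding tree_poly_def star_poly_def using y by (intro poly_rec_poly_nonneg; simp)+
    ultimately have "((y\<^sup>2 + 1)\<^sup>2 * (?T (n - 8) y * ?E 19 y * (y\<^sup>2 + 1)))\<^sup>2 \<le>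
        ((y\<^sup>2 + 1)\<^sup>2 * (?T 15 y * ?E (n - 4) y * (y\<^sup>2 + ?r\<^sup>2)))\<^sup>2"
      by (intro power_mono mult_left_mono mult_nonneg_nonneg) auto
    moreover have "(\<Prod>a\<leftarrow>ts @ es' @ [1, 1]. y\<^sup>2 + a\<^sup>2) =
        ((y\<^sup>2 + 1)\<^sup>2 * (?T (n - 8) y * ?E 19 y * (y\<^sup>2 + 1)))\<^sup>2"
      by (simp add: ts es' power_mult_distrib power2_eq_square[of "y\<^sup>2 + 1"] mult_ac)
    moreover have "(\<Prod>a\<leftarrow>ts' @ es @ [?r, ?r]. y\<^sup>2 + a\<^sup>2) =
        ((y\<^sup>2 + 1)\<^sup>2 * (?T 15 y * ?E (n - 4) y * (y\<^sup>2 + ?r\<^sup>2)))\<^sup>2"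
      by (simp add: ts' es power_mult_distrib power2_eq_square[of "y\<^sup>2 + _"] mult_ac)
    ultimately show "(\<Prod>a\<leftarrow>ts @ es' @ [1, 1]. y\<^sup>2 + a\<^sup>2) \<le> (\<Prod>a\<leftarrow>ts' @ es @ [?r, ?r]. y\<^sup>2 + a\<^sup>2)"
      by (simp only:)
  qed (simp add: ts ts' es es')
  then have "graph_energy (tree_T2222 n) + graph_energy (starlike_tree [2, 1, 19]) + 2 \<le>
      graph_energy (tree_T2222 23) + graph_energy (starlike_tree [2, 1, n - 4]) + 2 * ?r"
    unfolding ts(2) ts'(2) es(2) es'(2) by simp
  moreover have "graph_energy (starlike_tree [2, 1, 19]) = root_energy (star_poly (- 1) 19)"
    using graph_char_poly_starlike_tree[of 23] starlike_tree_wf[of "[2, 1, 19]"]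
    by (simp add: graph_energy_eq_root_energy char_poly_adjacency_mat)
  \<comment> \<open>Since \<open>2 * ?r - 2\<close> is 1/10000, what remains is an inequality
    between explicit rationals.\<close>
  ultimately show ?thesis
    using graph_energy_tree_T2222_23 root_energy_tree_poly_15 root_energy_star_poly_19
    by simp
qed

end
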